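(* Let $1\le k\le n$. For each $i=1,\ldots,n$, suppose $\mathbf{A}_i=\mathbf{Z}_i \mathbf{Z}_i^T$, where $\mathbf{Z}_1,\dots,\mathbf{Z}_n$ are independent $d\times r$ random matrices all of whose entries are i.i.d. samples from some (common) symmetric distribution on $\mathbb{R}$ with enough finite moments for the expectations below to exist (order $2k$ for the first inequality, order $4k$ for the second). Then, with $\mathbb{E}$ denoting expectation with respect to the random matrices $\mathbf{A}_1,\dots,\mathbf{A}_n$, $$\left\| \mathbb{E}\,\mathbb{E}_{\mathrm{wo}}\left[ \prod_{j=1}^k \mathbf{A}_{i_j} \right]\right\|\leq \left\| \mathbb{E}\,\mathbb{E}_{\mathrm{wr}}\left[ \prod_{j=1}^k \mathbf{A}_{i_j} \right]\right\|$$ and $$\left\| \mathbb{E}\,\mathbb{E}_{\mathrm{wo}}\left[ \prod_{j=1}^k \mathbf{A}_{i_{k-j+1}}\prod_{j=1}^k \mathbf{A}_{i_j}\right] \right\| \leq \left\| \mathbb{E}\,\mathbb{E}_{\mathrm{wr}}\left[ \prod_{j=1}^k \mathbf{A}_{i_{k-j+1}}\prod_{j=1}^k \mathbf{A}_{i_j}\right] \right\| .$$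
   Context: $\|\cdot\|$ is the operator (spectral) norm. A distribution is symmetric if $Z$ and $-Z$ have the same law. For a function $f$ of $k$ matrix arguments and a tuple $(\mathbf{A}_1,\dots,\mathbf{A}_n)$ with $k\le n$, the without-replacement expectation is $$\mathbb{E}_{\mathrm{wo}}[f(\mathbf{A}_{i_1},\ldots,\mathbf{A}_{i_k})]=\frac{(n-k)!}{n!}\sum_{j_1,\dots,j_k \text{ pairwise distinct in }\{1,\dots,n\}} f(\mathbf{A}_{j_1},\ldots,\mathbf{A}_{j_k}),$$ and the with-replacement expectation is $$\mathbb{E}_{\mathrm{wr}}[f(\mathbf{A}_{i_1},\ldots,\mathbf{A}_{i_k})]=n^{-k}\sum_{(j_1,\ldots,j_k)\in\{1,\dots,n\}^k} f(\mathbf{A}_{j_1},\ldots,\mathbf{A}_{j_k}).$$ Product convention: $\prod_{j=1}^k \mathbf{M}_j$ means $\mathbf{M}_k\mathbf{M}_{k-1}\cdots\mathbf{M}_1$, so that $\prod_{j=1}^k \mathbf{A}_{i_{k-j+1}}\prod_{j=1}^k \mathbf{A}_{i_j}=\mathbf{A}_{i_1}\cdots \mathbf{A}_{i_k}\mathbf{A}_{i_k}\cdots \mathbf{A}_{i_1}$. *)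

theory Defs
  imports "HOL-Probability.Probability"
begin

definition symmetric_distribution :: "real measure \<Rightarrow> bool" where
  "symmetric_distribution \<mu> \<longleftrightarrow> real_distribution \<mu> \<and> distr \<mu> borel uminus = \<mu>"

text \<open>A k-tuple is a function on the naturals of which only the values at
  \<open>1, \<dots>, k\<close> matter. Later factors stand on the left:
  \<open>ordered_prod k B = B k ** \<dots> ** B 1\<close>.\<close>

primrec ordered_prod :: "nat \<Rightarrow> (nat \<Rightarrow> real^'d^'d) \<Rightarrow> real^'d^'d" where
  "ordered_prod 0 B = mat 1"
| "ordered_prod (Suc k) B = B (Suc k) ** ordered_prod k B"

definition E_wo ::
  "nat \<Rightarrow> nat \<Rightarrow> ((nat \<Rightarrow> 'a) \<Rightarrow> 'b::real_vector) \<Rightarrow> (nat \<Rightarrow> 'a) \<Rightarrow> 'b" where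
  "E_wo n k f A = (fact (n - k) / fact n) *\<^sub>R
     (\<Sum>i \<in> {i \<in> {1..k} \<rightarrow>\<^sub>E {1..n}. inj_on i {1..k}}. f (\<lambda>j. A (i j)))"

definition E_wr ::
  "nat \<Rightarrow> nat \<Rightarrow> ((nat \<Rightarrow> 'a) \<Rightarrow> 'b::real_vector) \<Rightarrow> (nat \<Rightarrow> 'a) \<Rightarrow> 'b" where
  "E_wr n k f A = (1 / real n ^ k) *\<^sub>R
     (\<Sum>i \<in> {1..k} \<rightarrow>\<^sub>E {1..n}. f (\<lambda>j. A (i j)))"

end

(* A product of entries of the Z_i is a monomial in independent variables with law mu; by symmetry its
   expectation, a product of moments of mu, is nonnegative, and it vanishes when an exponent is odd.
   Chebyshev's association inequality for each moment shows that monomials, hence polynomials with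
   nonnegative coefficients, are positively correlated: E[f g] >= E[f] E[g], with equality when f and g
   involve disjoint sets of variables. For distinct indices the expected product is therefore a multiple
   c of the identity. For an arbitrary index tuple, dropping nonnegative terms from a diagonal entry and
   peeling off one factor at a time bounds that entry of the expected product below by the same c. *)

theory Submission
  imports Defs
begin

section \<open>Entrywise integration of matrices, ordered products, and the reduction to diagonal
  entries\<close>

lemma has_bochner_integral_vec:
  fixes F :: "'w \<Rightarrow> 'b::euclidean_space ^ 'm"
  assumes "\<And>a. has_bochner_integral M (\<lambda>\<omega>. F \<omega> $ a) (N $ a)"
  shows "has_bochner_integral M F N"
proof -
  \<comment> \<open>A vector is the sum of its coordinates placed along the axes, and each
    \<open>axis a\<close> is bounded linear, so the integrals of the coordinates assemble into the
    integral of the vector.\<close>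
  have expand: "x = (\<Sum>a\<in>UNIV. axis a (x $ a))" for x :: "'b ^ 'm"
    by (simp add: vec_eq_iff axis_def)
  have lin: "bounded_linear (axis a :: 'b \<Rightarrow> 'b ^ 'm)" for a
    by (rule bounded_linear_intro [where K = 1])
      (simp_all add: axis_def vec_eq_iff norm_vec_def L2_set_def if_distrib [of norm]
        if_distrib [of "\<lambda>t. t ^ 2"] cong: if_cong)
  have "has_bochner_integral M (\<lambda>\<omega>. \<Sum>a\<in>UNIV. axis a (F \<omega> $ a)) (\<Sum>a\<in>UNIV. axis a (N $ a))"
    by (intro has_bochner_integral_sum has_bochner_integral_bounded_linear [OF lin] assms)
  then show ?thesis
    by (simp flip: expand)
qed

lemma has_bochner_integral_matrix:
  fixes F :: "'w \<Rightarrow> real^'m^'d"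
  assumes "\<And>a b. integrable M (\<lambda>\<omega>. F \<omega> $ a $ b)"
  shows "has_bochner_integral M F (\<chi> a b. \<integral>\<omega>. F \<omega> $ a $ b \<partial>M)"
  using assms by (intro has_bochner_integral_vec) (simp add: has_bochner_integral_integrable)

lemma ordered_prod_cong:
  "(\<And>j. j \<in> {1..k} \<Longrightarrow> B j = C j) \<Longrightarrow> ordered_prod k B = ordered_prod k C"
  by (induction k) simp_all

text \<open>Transposition reverses a product of symmetric matrices. This turns the integrand of the
  second inequality into X^T X with X the ordered product.\<close>

lemma symmetric_matrix_rev_ordered_prod:
  assumes "\<And>j. j \<in> {1..k} \<Longrightarrow> transpose (B j) = B j"
  shows "ordered_prod k (\<lambda>j. B (k - j + 1)) = transpose (ordered_prod k B)"
proof -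
  \<comment> \<open>\<open>ordered_prod\<close> recurses at its left end, whereas in the reversed
    product the factor \<open>B (Suc k)\<close> stands at the right end.\<close>
  have shift: "ordered_prod (Suc k) B = ordered_prod k (\<lambda>j. B (Suc j)) ** B 1"
    for k and B :: "nat \<Rightarrow> real^'d^'d"
    by (induction k) (simp_all add: matrix_mul_assoc)
  show ?thesis
    using assms
  proof (induction k)
    case 0
    then show ?case by (simp add: transpose_mat)
  next
    case (Suc k)
    have "ordered_prod (Suc k) (\<lambda>j. B (Suc k - j + 1))
        = ordered_prod k (\<lambda>j. B (k - j + 1)) ** B (Suc k)"
      by (subst shift) simp
    also have "\<dots> = transpose (ordered_prod k B) ** transpose (B (Suc k))"
      using Suc by simp
    finally show ?case
      by (simp add: matrix_transpose_mul)
  qed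
qed

lemma onorm_scaleR_mat_1_le:
  fixes c :: real
  shows "onorm ((*v) (c *\<^sub>R mat 1 :: real^'d^'d)) \<le> \<bar>c\<bar>"
  by (rule onorm_bound) (simp_all add: scaleR_matrix_vector_assoc [symmetric])

text \<open>Reduces both inequalities to single tuples. If every injective tuple has expectation c
  times the identity, so has the average without replacement, and its norm is at most c. If every
  tuple has diagonal entries at least c, so has the average with replacement, and no entry exceeds
  the operator norm. \<open>g\<close> replaces the integrand because the two need agree only on
  \<open>space M\<close>.\<close>

lemma onorm_E_wo_le_E_wr:
  fixes f :: "(nat \<Rightarrow> 'a) \<Rightarrow> real^'d^'d" and A :: "nat \<Rightarrow> 'w \<Rightarrow> 'a"
  assumes "k \<le> n" "0 \<le> c"
    and g: "\<And>i \<omega>. i \<in> {1..k} \<rightarrow>\<^sub>E {1..n} \<Longrightarrow> \<omega> \<in> space M \<Longrightarrow> f (\<lambda>j. A (i j) \<omega>) = g i \<omega>"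
    and g_int: "\<And>i a b. i \<in> {1..k} \<rightarrow>\<^sub>E {1..n} \<Longrightarrow> integrable M (\<lambda>\<omega>. g i \<omega> $ a $ b)"
    and g_wo: "\<And>i a b. i \<in> {1..k} \<rightarrow>\<^sub>E {1..n} \<Longrightarrow> inj_on i {1..k} \<Longrightarrow>
      (\<integral>\<omega>. g i \<omega> $ a $ b \<partial>M) = (if a = b then c else 0)"
    and g_wr: "\<And>i a. i \<in> {1..k} \<rightarrow>\<^sub>E {1..n} \<Longrightarrow> c \<le> (\<integral>\<omega>. g i \<omega> $ a $ a \<partial>M)"
  shows "onorm ((*v) (\<integral>\<omega>. E_wo n k f (\<lambda>i. A i \<omega>) \<partial>M))
      \<le> onorm ((*v) (\<integral>\<omega>. E_wr n k f (\<lambda>i. A i \<omega>) \<partial>M))"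
proof -
  let ?T = "{1..k} \<rightarrow>\<^sub>E {1..n}"
  let ?J = "{i \<in> ?T. inj_on i {1..k}}"
  let ?I = "\<lambda>i. \<integral>\<omega>. f (\<lambda>j. A (i j) \<omega>) \<partial>M"
  have hbi: "has_bochner_integral M (\<lambda>\<omega>. f (\<lambda>j. A (i j) \<omega>)) (\<chi> a b. \<integral>\<omega>. g i \<omega> $ a $ b \<partial>M)"
    if "i \<in> ?T" for i
    using has_bochner_integral_matrix [OF g_int [OF that]] g [OF that]
    by (subst has_bochner_integral_cong [OF refl _ refl]) auto
  have int: "integrable M (\<lambda>\<omega>. f (\<lambda>j. A (i j) \<omega>))" if "i \<in> ?T" for i
    using hbi [OF that] by (rule integrable.intros)
  have I: "?I i = (\<chi> a b. \<integral>\<omega>. g i \<omega> $ a $ b \<partial>M)" if "i \<in> ?T" for i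
    using hbi [OF that] by (rule has_bochner_integral_integral_eq)
  have wo: "?I i = c *\<^sub>R mat 1" if "i \<in> ?T" "inj_on i {1..k}" for i
    using I [OF that(1)] g_wo [OF that] by (simp add: vec_eq_iff mat_def)
  have wr: "c \<le> ?I i $ a $ a" if "i \<in> ?T" for i a
    using I [OF that] g_wr [OF that] by simp
  \<comment> \<open>The number of injective tuples is the falling factorial of n, the inverse of the
    normalising factor in \<open>E_wo\<close>.\<close>
  have "(\<Prod>j<k. n - j) * fact (n - k) = fact n"
    using \<open>k \<le> n\<close>
  proof (induction k)
    case (Suc k)
    have "fact (n - k) = (n - k) * fact (n - Suc k)"
      using Suc.prems by (simp add: fact_reduce)
    then show ?case
      using Suc by (simp add: algebra_simps)
  qed simp
  moreover have "card ?J = (\<Prod>j<k. n - j)"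
    using card_inj_on_subset_funcset [of "{1..k}" "{1..n}" "{1..k}"] by (simp add: atLeast0LessThan)
  ultimately have "real (card ?J) * fact (n - k) = fact n"
    by (metis of_nat_fact of_nat_mult)
  then have card: "real (card ?J) = fact n / fact (n - k)"
    by (simp add: field_simps)
  have "(\<integral>\<omega>. E_wo n k f (\<lambda>i. A i \<omega>) \<partial>M) = (fact (n - k) / fact n) *\<^sub>R (\<Sum>i\<in>?J. ?I i)"
    unfolding E_wo_def by (subst integral_scaleR_right, subst Bochner_Integration.integral_sum)
      (auto intro: int simp del: One_nat_def)
  also have "(\<Sum>i\<in>?J. ?I i) = (\<Sum>i\<in>?J. c *\<^sub>R mat 1)"
    by (rule sum.cong) (auto intro: wo simp del: One_nat_def)
  also have "(fact (n - k) / fact n) *\<^sub>R \<dots> = c *\<^sub>R mat 1"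
    by (simp only: sum_constant_scaleR card) simp
  finally have "onorm ((*v) (\<integral>\<omega>. E_wo n k f (\<lambda>i. A i \<omega>) \<partial>M)) \<le> c"
    using onorm_scaleR_mat_1_le [of c] \<open>0 \<le> c\<close> by simp
  also have "c \<le> (\<integral>\<omega>. E_wr n k f (\<lambda>i. A i \<omega>) \<partial>M) $ a $ a" for a
  proof -
    have "(\<integral>\<omega>. E_wr n k f (\<lambda>i. A i \<omega>) \<partial>M) = (1 / real n ^ k) *\<^sub>R (\<Sum>i\<in>?T. ?I i)"
      unfolding E_wr_def by (subst integral_scaleR_right, subst Bochner_Integration.integral_sum)
        (auto intro: int simp del: One_nat_def)
    moreover have "real n ^ k * c \<le> (\<Sum>i\<in>?T. ?I i $ a $ a)"
    proof -
      have "real n ^ k * c = (\<Sum>i\<in>?T. c)"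
        by (simp add: card_PiE)
      also have "\<dots> \<le> (\<Sum>i\<in>?T. ?I i $ a $ a)"
        by (rule sum_mono) (rule wr)
      finally show ?thesis .
    qed
    moreover have "real n ^ k > 0"
      using \<open>k \<le> n\<close> by (cases k) simp_all
    ultimately show ?thesis
      by (simp add: sum_component field_simps)
  qed
  then have "c \<le> onorm ((*v) (\<integral>\<omega>. E_wr n k f (\<lambda>i. A i \<omega>) \<partial>M))"
    by (meson abs_ge_self matrix_component_le_onorm order_trans)
  finally show ?thesis .
qed

section \<open>Moments of a symmetric distribution\<close>

definition moment :: "real measure \<Rightarrow> nat \<Rightarrow> real" where
  "moment \<mu> e = (\<integral>x. x ^ e \<partial>\<mu>)"

text \<open>Comparing the cases |x| \<le> 1 and |x| > 1 gives |x|^e \<le> 1 + |x|^D, and constants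
  are integrable because the total mass is finite.\<close>

lemma integrable_power_le:
  assumes "real_distribution \<mu>" "integrable \<mu> (\<lambda>x. \<bar>x\<bar> ^ D)" "e \<le> D"
  shows "integrable \<mu> (\<lambda>x. x ^ e)"
proof -
  interpret real_distribution \<mu> by fact
  have le: "\<bar>x\<bar> ^ e \<le> 1 + \<bar>x\<bar> ^ D" for x :: real
  proof (cases "\<bar>x\<bar> \<le> 1")
    case True
    then show ?thesis by (simp add: add_increasing2 power_le_one)
  next
    case False
    then have "\<bar>x\<bar> ^ e \<le> \<bar>x\<bar> ^ D"
      using \<open>e \<le> D\<close> by (intro power_increasing) auto
    then show ?thesis by simp
  qed
  show ?thesis
    by (rule Bochner_Integration.integrable_bound [where f = "\<lambda>x. 1 + \<bar>x\<bar> ^ D"])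
      (use assms le in \<open>auto simp: power_abs intro!: AE_I2\<close>)
qed

lemma moment_0: "real_distribution \<mu> \<Longrightarrow> moment \<mu> 0 = 1"
proof -
  assume "real_distribution \<mu>"
  then interpret real_distribution \<mu> .
  show ?thesis using prob_space by (simp add: moment_def)
qed

text \<open>Reflection invariance shows that the moment equals its own negative. The integral
  identities also cover a non-integrable power, whose Bochner integral is 0 by default.\<close>

lemma moment_odd:
  assumes "symmetric_distribution \<mu>" "odd e"
  shows "moment \<mu> e = 0"
proof -
  interpret real_distribution \<mu>
    using assms by (simp add: symmetric_distribution_def)
  have "moment \<mu> e = (\<integral>x. x ^ e \<partial>distr \<mu> borel uminus)"
    using assms by (simp add: moment_def symmetric_distribution_def)
  also have "\<dots> = (\<integral>x. (- x) ^ e \<partial>\<mu>)"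
    by (rule integral_distr) auto
  also have "\<dots> = - moment \<mu> e"
    using \<open>odd e\<close> by (simp add: moment_def)
  finally show ?thesis by simp
qed

lemma moment_nonneg:
  assumes "symmetric_distribution \<mu>"
  shows "0 \<le> moment \<mu> e"
proof (cases "even e")
  case True
  then show ?thesis by (auto simp: moment_def intro!: integral_nonneg_AE AE_I2)
qed (simp add: moment_odd assms)

text \<open>For even exponents this is Chebyshev's association inequality.\<close>

lemma moment_add_ge:
  assumes sym: "symmetric_distribution \<mu>" and int: "integrable \<mu> (\<lambda>x. \<bar>x\<bar> ^ D)" and "e + f \<le> D"
  shows "moment \<mu> e * moment \<mu> f \<le> moment \<mu> (e + f)"
proof (cases "even e \<and> even f")
  \<comment> \<open>If an exponent is odd, the left side is 0 and the right side is
    nonnegative.\<close>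
  case False
  then show ?thesis
    using moment_nonneg [OF sym] moment_odd [OF sym] by auto
next
  case True
  have rd: "real_distribution \<mu>"
    using sym by (simp add: symmetric_distribution_def)
  then interpret real_distribution \<mu> .
  have [simp]: "integrable \<mu> (\<lambda>x. x ^ e)" "integrable \<mu> (\<lambda>x. x ^ f)" "integrable \<mu> (\<lambda>x. x ^ e * x ^ f)"
    using integrable_power_le [OF rd int, of e] integrable_power_le [OF rd int, of f]
      integrable_power_le [OF rd int, of "e + f"] \<open>e + f \<le> D\<close> by (simp_all add: power_add)
  have [simp]: "measure \<mu> UNIV = 1"
    using prob_space by simp
  have mef: "(\<integral>x. x ^ e * x ^ f \<partial>\<mu>) = moment \<mu> (e + f)"
    by (simp add: moment_def power_add)
  \<comment> \<open>Even powers are increasing functions of the absolute value, so the two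
    differences never have opposite signs.\<close>
  have comonotone: "0 \<le> (x ^ e - y ^ e) * (x ^ f - y ^ f)" for x y :: real
  proof -
    have ev: "x ^ e = \<bar>x\<bar> ^ e" "y ^ e = \<bar>y\<bar> ^ e" "x ^ f = \<bar>x\<bar> ^ f" "y ^ f = \<bar>y\<bar> ^ f"
      using True by (simp_all add: power_even_abs)
    show ?thesis
      unfolding ev
    proof (cases "\<bar>x\<bar>" "\<bar>y\<bar>" rule: le_cases)
      case le
      then show "0 \<le> (\<bar>x\<bar> ^ e - \<bar>y\<bar> ^ e) * (\<bar>x\<bar> ^ f - \<bar>y\<bar> ^ f)"
        by (intro mult_nonpos_nonpos) (simp_all add: power_mono)
    next
      case ge
      then show "0 \<le> (\<bar>x\<bar> ^ e - \<bar>y\<bar> ^ e) * (\<bar>x\<bar> ^ f - \<bar>y\<bar> ^ f)"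
        by (intro mult_nonneg_nonneg) (simp_all add: power_mono)
    qed
  qed
  \<comment> \<open>Two independent copies of the variable are handled by iterated integration,
    first over x with y fixed and then over y. The final value is twice the covariance of the two
    powers.\<close>
  have inner: "0 \<le> moment \<mu> (e + f) - moment \<mu> e * y ^ f - moment \<mu> f * y ^ e + y ^ e * y ^ f" for y
  proof -
    have "0 \<le> (\<integral>x. (x ^ e - y ^ e) * (x ^ f - y ^ f) \<partial>\<mu>)"
      by (intro integral_nonneg_AE AE_I2 comonotone)
    also have "\<dots> = (\<integral>x. x ^ e * x ^ f - x ^ e * y ^ f - x ^ f * y ^ e + y ^ e * y ^ f \<partial>\<mu>)"
      by (simp add: algebra_simps)
    also have "\<dots> = moment \<mu> (e + f) - moment \<mu> e * y ^ f - moment \<mu> f * y ^ e + y ^ e * y ^ f"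
      by (simp add: mef) (simp add: moment_def prob_space)
    finally show ?thesis .
  qed
  have "0 \<le> (\<integral>y. moment \<mu> (e + f) - moment \<mu> e * y ^ f - moment \<mu> f * y ^ e + y ^ e * y ^ f \<partial>\<mu>)"
    by (intro integral_nonneg_AE AE_I2 inner)
  also have "\<dots> = 2 * (moment \<mu> (e + f) - moment \<mu> e * moment \<mu> f)"
    by (simp add: mef prob_space) (simp add: moment_def)
  finally show ?thesis by simp
qed

text \<open>A multiset of variables encodes a monomial, with multiplicities as exponents. The value
  is its expectation when the variables are independent with law \<mu>.\<close>

definition monomial_moment :: "real measure \<Rightarrow> 'v multiset \<Rightarrow> real" where
  "monomial_moment \<mu> m = (\<Prod>v\<in>set_mset m. moment \<mu> (count m v))"

lemma monomial_moment_superset: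
  assumes "real_distribution \<mu>" "finite V" "set_mset m \<subseteq> V"
  shows "monomial_moment \<mu> m = (\<Prod>v\<in>V. moment \<mu> (count m v))"
  unfolding monomial_moment_def
  by (rule prod.mono_neutral_left) (use assms in \<open>auto simp: moment_0 not_in_iff\<close>)

lemma monomial_moment_nonneg: "symmetric_distribution \<mu> \<Longrightarrow> 0 \<le> monomial_moment \<mu> m"
  by (simp add: monomial_moment_def prod_nonneg moment_nonneg)

text \<open>Chebyshev's inequality is applied to each variable separately; the factors are
  nonnegative, so the inequalities multiply. The bound on the sizes keeps every exponent within the
  finite moments.\<close>

lemma monomial_moment_add_ge:
  assumes sym: "symmetric_distribution \<mu>" and int: "integrable \<mu> (\<lambda>x. \<bar>x\<bar> ^ D)"
    and "size l + size m \<le> D"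
  shows "monomial_moment \<mu> l * monomial_moment \<mu> m \<le> monomial_moment \<mu> (l + m)"
proof -
  have rd: "real_distribution \<mu>"
    using sym by (simp add: symmetric_distribution_def)
  let ?V = "set_mset l \<union> set_mset m"
  have "count l v + count m v \<le> D" for v
    using count_le_size [of "l + m" v] assms(3) by simp
  then have "(\<Prod>v\<in>?V. moment \<mu> (count l v) * moment \<mu> (count m v))
      \<le> (\<Prod>v\<in>?V. moment \<mu> (count l v + count m v))"
    by (intro prod_mono conjI mult_nonneg_nonneg moment_nonneg moment_add_ge [OF sym int] sym) simp
  then show ?thesis
    by (simp add: monomial_moment_superset [OF rd, of ?V] prod.distrib)
qed

lemma monomial_moment_add_disjoint:
  assumes "real_distribution \<mu>" "set_mset l \<inter> set_mset m = {}"
  shows "monomial_moment \<mu> (l + m) = monomial_moment \<mu> l * monomial_moment \<mu> m"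
proof -
  have "monomial_moment \<mu> (l + m) = (\<Prod>v\<in>set_mset l. moment \<mu> (count l v + count m v))
      * (\<Prod>v\<in>set_mset m. moment \<mu> (count l v + count m v))"
    using assms by (simp add: monomial_moment_def prod.union_disjoint)
  moreover have "count m v = 0" if "v \<in># l" for v
    using that assms(2) by (auto simp: count_eq_zero_iff)
  moreover have "count l v = 0" if "v \<in># m" for v
    using that assms(2) by (auto simp: count_eq_zero_iff)
  ultimately show ?thesis by (simp add: monomial_moment_def)
qed

text \<open>An odd total degree in the variables selected by \<open>P\<close> forces an odd exponent
  on one of them, whose moment is 0. Letting \<open>P\<close> select a row makes off-diagonal
  expectations vanish.\<close>

lemma monomial_moment_odd:
  assumes "symmetric_distribution \<mu>" "odd (size (filter_mset P m))"
  shows "monomial_moment \<mu> m = 0"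
proof -
  have "size (filter_mset P m) = (\<Sum>v\<in>set_mset (filter_mset P m). count m v)"
    by (simp add: size_multiset_overloaded_eq)
  then obtain v where "v \<in># m" "odd (count m v)"
    using assms(2) by (metis (no_types, lifting) dvd_sum mem_Collect_eq set_mset_filter)
  then show ?thesis
    using moment_odd [OF assms(1)] by (auto simp: monomial_moment_def)
qed

text \<open>Only the exponents matter, as all variables have the same law. Renaming indices thus
  shows that constants are the same for all matrices and rows.\<close>

lemma monomial_moment_image_inj:
  assumes "inj h"
  shows "monomial_moment \<mu> (image_mset h m) = monomial_moment \<mu> m"
proof -
  have "count (image_mset h m) (h v) = count m v" for v
    using assms by (induction m) (simp_all add: inj_eq)
  then show ?thesis
    using assms by (simp add: monomial_moment_def prod.reindex inj_on_subset [OF assms])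
qed

section \<open>Polynomials with nonnegative coefficients\<close>

lemma sum_mset_mult_sum_mset:
  fixes f :: "'a \<Rightarrow> 'c::semiring_0" and g :: "'b \<Rightarrow> 'c"
  shows "(\<Sum>x\<in>#A. f x) * (\<Sum>y\<in>#B. g y) = (\<Sum>x\<in>#A. \<Sum>y\<in>#B. f x * g y)"
  by (induction A) (simp_all add: distrib_right flip: sum_mset_distrib_left)

text \<open>Isolates what the algebra uses of the probability model: the expectations of monomials
  of degree at most \<open>D\<close>, the order up to which moments are known to be finite.\<close>

locale symmetric_moments =
  fixes M :: "'w measure" and \<mu> :: "real measure" and x :: "'v \<Rightarrow> 'w \<Rightarrow> real"
    and V :: "'v set" and D :: nat
  assumes sym: "symmetric_distribution \<mu>"
    and integrable_D: "integrable \<mu> (\<lambda>t. \<bar>t\<bar> ^ D)"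
    and monomial: "\<And>m. set_mset m \<subseteq> V \<Longrightarrow> size m \<le> D \<Longrightarrow>
      has_bochner_integral M (\<lambda>\<omega>. \<Prod>v\<in>#m. x v \<omega>) (monomial_moment \<mu> m)"
begin

text \<open>The multiset \<open>P\<close> lists the monomials with repetition, so coefficients are natural numbers.\<close>

definition pos_poly :: "'v set \<Rightarrow> nat \<Rightarrow> ('w \<Rightarrow> real) \<Rightarrow> bool" where
  "pos_poly S d f \<longleftrightarrow> (\<exists>P. (\<forall>m\<in>#P. set_mset m \<subseteq> S \<and> size m \<le> d) \<and>
    f = (\<lambda>\<omega>. \<Sum>m\<in>#P. \<Prod>v\<in>#m. x v \<omega>))"

lemma pos_polyE:
  assumes "pos_poly S d f"
  obtains P where "\<And>m. m \<in># P \<Longrightarrow> set_mset m \<subseteq> S" "\<And>m. m \<in># P \<Longrightarrow> size m \<le> d"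
    "f = (\<lambda>\<omega>. \<Sum>m\<in>#P. \<Prod>v\<in>#m. x v \<omega>)"
  using assms unfolding pos_poly_def by blast

lemma pos_poly_mono: "pos_poly S d f \<Longrightarrow> S \<subseteq> T \<Longrightarrow> d \<le> e \<Longrightarrow> pos_poly T e f"
  unfolding pos_poly_def by (elim exE conjE) (intro exI conjI, auto intro: order_trans)

lemma pos_poly_0: "pos_poly S d (\<lambda>_. 0)"
  unfolding pos_poly_def by (rule exI [of _ "{#}"]) simp

lemma pos_poly_1: "pos_poly S d (\<lambda>_. 1)"
  unfolding pos_poly_def by (rule exI [of _ "{#{#}#}"]) simp

lemma pos_poly_var: "v \<in> S \<Longrightarrow> pos_poly S 1 (x v)"
  unfolding pos_poly_def by (rule exI [of _ "{#{#v#}#}"]) simp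

lemma pos_poly_add:
  assumes "pos_poly S d f" "pos_poly S d g"
  shows "pos_poly S d (\<lambda>\<omega>. f \<omega> + g \<omega>)"
proof -
  obtain P Q where "\<And>m. m \<in># P \<Longrightarrow> set_mset m \<subseteq> S \<and> size m \<le> d"
    "f = (\<lambda>\<omega>. \<Sum>m\<in>#P. \<Prod>v\<in>#m. x v \<omega>)"
    "\<And>m. m \<in># Q \<Longrightarrow> set_mset m \<subseteq> S \<and> size m \<le> d"
    "g = (\<lambda>\<omega>. \<Sum>m\<in>#Q. \<Prod>v\<in>#m. x v \<omega>)"
    using assms unfolding pos_poly_def by blast
  then show ?thesis
    unfolding pos_poly_def by (intro exI [of _ "P + Q"]) auto
qed

lemma pos_poly_sum: "(\<And>i. i \<in> A \<Longrightarrow> pos_poly S d (f i)) \<Longrightarrow> pos_poly S d (\<lambda>\<omega>. \<Sum>i\<in>A. f i \<omega>)"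
  by (induction A rule: infinite_finite_induct) (simp_all add: pos_poly_0 pos_poly_add)

lemma pos_poly_sum_mset:
  "(\<And>m. m \<in># P \<Longrightarrow> pos_poly S d (f m)) \<Longrightarrow> pos_poly S d (\<lambda>\<omega>. \<Sum>m\<in>#P. f m \<omega>)"
  by (induction P) (simp_all add: pos_poly_0 pos_poly_add)

text \<open>Monomials multiply by multiset addition, so variable sets unite and degrees add.
  Tracking the set detects disjoint variables; tracking the degree ensures integrability.\<close>

lemma pos_poly_mult:
  assumes "pos_poly S d f" "pos_poly T e g"
  shows "pos_poly (S \<union> T) (d + e) (\<lambda>\<omega>. f \<omega> * g \<omega>)"
proof -
  obtain P where P: "\<And>m. m \<in># P \<Longrightarrow> set_mset m \<subseteq> S" "\<And>m. m \<in># P \<Longrightarrow> size m \<le> d"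
    "f = (\<lambda>\<omega>. \<Sum>m\<in>#P. \<Prod>v\<in>#m. x v \<omega>)"
    using assms(1) by (rule pos_polyE) (rule that)
  obtain Q where Q: "\<And>m. m \<in># Q \<Longrightarrow> set_mset m \<subseteq> T" "\<And>m. m \<in># Q \<Longrightarrow> size m \<le> e"
    "g = (\<lambda>\<omega>. \<Sum>m\<in>#Q. \<Prod>v\<in>#m. x v \<omega>)"
    using assms(2) by (rule pos_polyE) (rule that)
  have "pos_poly (S \<union> T) (d + e) (\<lambda>\<omega>. \<Sum>l\<in>#P. \<Sum>m\<in>#Q. \<Prod>v\<in>#l + m. x v \<omega>)"
  proof (intro pos_poly_sum_mset)
    fix l m assume "l \<in># P" "m \<in># Q"
    then have "set_mset (l + m) \<subseteq> S \<union> T" "size (l + m) \<le> d + e"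
      using P(1,2) [of l] Q(1,2) [of m] by (auto intro: add_mono)
    then show "pos_poly (S \<union> T) (d + e) (\<lambda>\<omega>. \<Prod>v\<in>#l + m. x v \<omega>)"
      unfolding pos_poly_def by (intro exI [of _ "{#l + m#}"]) simp
  qed
  moreover have "(\<lambda>\<omega>. f \<omega> * g \<omega>) = (\<lambda>\<omega>. \<Sum>l\<in>#P. \<Sum>m\<in>#Q. \<Prod>v\<in>#l + m. x v \<omega>)"
    unfolding P(3) Q(3) by (simp add: sum_mset_mult_sum_mset)
  ultimately show ?thesis by simp
qed

lemma integral_1: "(\<integral>\<omega>. 1 \<partial>M) = (1::real)"
  using has_bochner_integral_integral_eq [OF monomial [of "{#}"]] by (simp add: monomial_moment_def)

lemma has_bochner_integral_poly:
  assumes "\<And>m. m \<in># P \<Longrightarrow> set_mset m \<subseteq> V" "\<And>m. m \<in># P \<Longrightarrow> size m \<le> D"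
  shows "has_bochner_integral M (\<lambda>\<omega>. \<Sum>m\<in>#P. \<Prod>v\<in>#m. x v \<omega>) (\<Sum>m\<in>#P. monomial_moment \<mu> m)"
  using assms by (induction P) (auto intro!: has_bochner_integral_add monomial)

lemma pos_poly_integrable:
  assumes "pos_poly V d f" "d \<le> D"
  shows "integrable M f"
  using assms(1)
proof (rule pos_polyE)
  fix P assume "\<And>m. m \<in># P \<Longrightarrow> set_mset m \<subseteq> V" "\<And>m. m \<in># P \<Longrightarrow> size m \<le> d"
    and f: "f = (\<lambda>\<omega>. \<Sum>m\<in>#P. \<Prod>v\<in>#m. x v \<omega>)"
  then show ?thesis
    unfolding f using \<open>d \<le> D\<close>
    by (intro integrable.intros [OF has_bochner_integral_poly]) (auto intro: order_trans)
qed

text \<open>Such a polynomial may take negative values, but its integral is a sum of monomial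
  moments, all of them nonnegative.\<close>

lemma pos_poly_integral_nonneg:
  assumes "pos_poly V d f" "d \<le> D"
  shows "0 \<le> integral\<^sup>L M f"
  using assms(1)
proof (rule pos_polyE)
  fix P assume P: "\<And>m. m \<in># P \<Longrightarrow> set_mset m \<subseteq> V" "\<And>m. m \<in># P \<Longrightarrow> size m \<le> d"
    and f: "f = (\<lambda>\<omega>. \<Sum>m\<in>#P. \<Prod>v\<in>#m. x v \<omega>)"
  have "integral\<^sup>L M f = (\<Sum>m\<in>#P. monomial_moment \<mu> m)"
    unfolding f using P \<open>d \<le> D\<close>
    by (intro has_bochner_integral_integral_eq has_bochner_integral_poly) (auto intro: order_trans)
  also have "\<dots> \<ge> 0"
    by (induction P) (simp_all add: monomial_moment_nonneg [OF sym])
  finally show ?thesis .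
qed

text \<open>Expanding both factors into monomials reduces each claim to pairs l, m, where the moment
  of l + m is compared with the product of the two moments.\<close>

lemma pos_poly_integral_mult:
  assumes "pos_poly S d f" "pos_poly T e g" "S \<subseteq> V" "T \<subseteq> V" "d + e \<le> D"
  shows pos_poly_integral_mult_ge: "integral\<^sup>L M f * integral\<^sup>L M g \<le> (\<integral>\<omega>. f \<omega> * g \<omega> \<partial>M)"
    and pos_poly_integral_mult_disjoint:
      "S \<inter> T = {} \<Longrightarrow> (\<integral>\<omega>. f \<omega> * g \<omega> \<partial>M) = integral\<^sup>L M f * integral\<^sup>L M g"
proof -
  obtain P where P: "\<And>m. m \<in># P \<Longrightarrow> set_mset m \<subseteq> S" "\<And>m. m \<in># P \<Longrightarrow> size m \<le> d"
    and f: "f = (\<lambda>\<omega>. \<Sum>m\<in>#P. \<Prod>v\<in>#m. x v \<omega>)"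
    using assms(1) by (rule pos_polyE) (rule that)
  obtain Q where Q: "\<And>m. m \<in># Q \<Longrightarrow> set_mset m \<subseteq> T" "\<And>m. m \<in># Q \<Longrightarrow> size m \<le> e"
    and g: "g = (\<lambda>\<omega>. \<Sum>m\<in>#Q. \<Prod>v\<in>#m. x v \<omega>)"
    using assms(2) by (rule pos_polyE) (rule that)
  have PD: "set_mset m \<subseteq> V" "size m \<le> D" if "m \<in># P" for m
    using P [OF that] assms(3,5) by auto
  have QD: "set_mset m \<subseteq> V" "size m \<le> D" if "m \<in># Q" for m
    using Q [OF that] assms(4,5) by auto
  have PQ: "set_mset (l + m) \<subseteq> V" "size (l + m) \<le> D" if "l \<in># P" "m \<in># Q" for l m
    using P [OF that(1)] Q [OF that(2)] assms(3-5) by auto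
  have int_f: "integral\<^sup>L M f = (\<Sum>l\<in>#P. monomial_moment \<mu> l)"
    unfolding f by (intro has_bochner_integral_integral_eq has_bochner_integral_poly PD)
  have int_g: "integral\<^sup>L M g = (\<Sum>m\<in>#Q. monomial_moment \<mu> m)"
    unfolding g by (intro has_bochner_integral_integral_eq has_bochner_integral_poly QD)
  have sum_int: "has_bochner_integral M (\<lambda>\<omega>. \<Sum>l\<in>#R. h l \<omega>) (\<Sum>l\<in>#R. c l)"
    if "\<And>l. l \<in># R \<Longrightarrow> has_bochner_integral M (h l) (c l)"
    for R :: "'v multiset multiset" and h :: "'v multiset \<Rightarrow> 'w \<Rightarrow> real" and c
    using that by (induction R) auto
  have "has_bochner_integral M (\<lambda>\<omega>. \<Sum>l\<in>#P. \<Sum>m\<in>#Q. \<Prod>v\<in>#l + m. x v \<omega>)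
      (\<Sum>l\<in>#P. \<Sum>m\<in>#Q. monomial_moment \<mu> (l + m))"
    by (intro sum_int monomial PQ)
  then have int_fg: "(\<integral>\<omega>. f \<omega> * g \<omega> \<partial>M) = (\<Sum>l\<in>#P. \<Sum>m\<in>#Q. monomial_moment \<mu> (l + m))"
    unfolding f g by (simp add: sum_mset_mult_sum_mset has_bochner_integral_integral_eq)
  have prod: "integral\<^sup>L M f * integral\<^sup>L M g
      = (\<Sum>l\<in>#P. \<Sum>m\<in>#Q. monomial_moment \<mu> l * monomial_moment \<mu> m)"
    unfolding int_f int_g by (simp add: sum_mset_mult_sum_mset)
  show "integral\<^sup>L M f * integral\<^sup>L M g \<le> (\<integral>\<omega>. f \<omega> * g \<omega> \<partial>M)"
    unfolding int_fg prod
    by (intro sum_mset_mono monomial_moment_add_ge [OF sym integrable_D]) (use PQ in auto)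
  show "(\<integral>\<omega>. f \<omega> * g \<omega> \<partial>M) = integral\<^sup>L M f * integral\<^sup>L M g" if disj: "S \<inter> T = {}"
  proof -
    have "monomial_moment \<mu> (l + m) = monomial_moment \<mu> l * monomial_moment \<mu> m"
      if "l \<in># P" "m \<in># Q" for l m
      using sym P(1) [OF that(1)] Q(1) [OF that(2)] disj
      by (intro monomial_moment_add_disjoint) (auto simp: symmetric_distribution_def)
    then show ?thesis
      unfolding int_fg prod by (simp cong: image_mset_cong)
  qed
qed

end

section \<open>Monomial expectations from the independence assumptions\<close>

text \<open>Independence is used at two levels: across the matrices the monomial factors into one
  polynomial per matrix, and within a matrix each polynomial factors into powers of single
  entries.\<close>

lemma (in prob_space) has_bochner_integral_monomial:
  fixes Z :: "'i \<Rightarrow> 'a \<Rightarrow> real^'r^'d"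
  assumes sym: "symmetric_distribution \<mu>" and int: "integrable \<mu> (\<lambda>t. \<bar>t\<bar> ^ D)" and "finite I"
    and indep: "indep_vars (\<lambda>_. borel) Z I"
    and indep_entries: "\<And>i. i \<in> I \<Longrightarrow> indep_vars (\<lambda>_. borel) (\<lambda>(a, b) \<omega>. Z i \<omega> $ a $ b) UNIV"
    and distr: "\<And>i a b. i \<in> I \<Longrightarrow> distr M borel (\<lambda>\<omega>. Z i \<omega> $ a $ b) = \<mu>"
    and m: "set_mset m \<subseteq> I \<times> UNIV" "size m \<le> D"
  shows "has_bochner_integral M (\<lambda>\<omega>. \<Prod>v\<in>#m. (\<lambda>(i, a, b) \<omega>. Z i \<omega> $ a $ b) v \<omega>) (monomial_moment \<mu> m)"
proof -
  have rd: "real_distribution \<mu>"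
    using sym by (simp add: symmetric_distribution_def)
  \<comment> \<open>\<open>G i\<close> collects the factors of the monomial that belong to the
    matrix \<open>Z i\<close>.\<close>
  define G :: "'i \<Rightarrow> real^'r^'d \<Rightarrow> real" where
    "G i z = (\<Prod>(a, b)\<in>UNIV. z $ a $ b ^ count m (i, a, b))" for i z
  have G: "integrable M (\<lambda>\<omega>. G i (Z i \<omega>))"
      "(\<integral>\<omega>. G i (Z i \<omega>) \<partial>M) = (\<Prod>p\<in>UNIV. moment \<mu> (count m (i, p)))" if "i \<in> I" for i
  proof -
    have "indep_vars (\<lambda>_. borel) (\<lambda>p \<omega>. ((\<lambda>(a, b) \<omega>. Z i \<omega> $ a $ b) p \<omega>) ^ count m (i, p)) UNIV"
      by (rule indep_vars_compose2 [OF indep_entries [OF that]]) simp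
    then have ind: "indep_vars (\<lambda>_. borel) (\<lambda>p \<omega>. Z i \<omega> $ fst p $ snd p ^ count m (i, p)) UNIV"
      by (simp add: case_prod_unfold)
    have entry: "(\<lambda>\<omega>. Z i \<omega> $ a $ b) \<in> borel_measurable M" for a b
      using indep_entries [OF that] by (auto simp: indep_vars_def)
    have "integrable \<mu> (\<lambda>t. t ^ count m (i, p))" for p
      using m(2) count_le_size [of m "(i, p)"] by (intro integrable_power_le [OF rd int]) simp
    then have power: "integrable M (\<lambda>\<omega>. Z i \<omega> $ fst p $ snd p ^ count m (i, p))" for p
      by (subst (asm) distr [OF that, of "fst p" "snd p", symmetric])
        (simp add: integrable_distr_eq [OF entry])
    have "(\<integral>\<omega>. Z i \<omega> $ fst p $ snd p ^ count m (i, p) \<partial>M) = moment \<mu> (count m (i, p))" for p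
      unfolding moment_def
      by (subst distr [OF that, of "fst p" "snd p", symmetric], subst integral_distr [OF entry]) auto
    then show "integrable M (\<lambda>\<omega>. G i (Z i \<omega>))"
        "(\<integral>\<omega>. G i (Z i \<omega>) \<partial>M) = (\<Prod>p\<in>UNIV. moment \<mu> (count m (i, p)))"
      using indep_vars_integrable [OF _ ind power] indep_vars_lebesgue_integral [OF _ ind power]
      by (simp_all add: G_def case_prod_unfold)
  qed
  have "G i \<in> borel_measurable borel" for i
    unfolding G_def case_prod_unfold
    by (intro borel_measurable_continuous_onI continuous_intros)
  then have ind: "indep_vars (\<lambda>_. borel) (\<lambda>i \<omega>. G i (Z i \<omega>)) I"
    by (intro indep_vars_compose2 [OF indep]) simp
  have "(\<Prod>v\<in>#m. (\<lambda>(i, a, b) \<omega>. Z i \<omega> $ a $ b) v \<omega>) = (\<Prod>i\<in>I. G i (Z i \<omega>))" for \<omega>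
  proof -
    have "(\<Prod>v\<in>#m. (\<lambda>(i, a, b) \<omega>. Z i \<omega> $ a $ b) v \<omega>)
        = (\<Prod>v\<in>I \<times> UNIV. ((\<lambda>(i, a, b) \<omega>. Z i \<omega> $ a $ b) v \<omega>) ^ count m v)"
      unfolding image_prod_mset_multiplicity
      by (rule prod.mono_neutral_left) (use m(1) \<open>finite I\<close> in \<open>auto simp: not_in_iff\<close>)
    then show ?thesis
      by (simp add: G_def prod.cartesian_product case_prod_unfold)
  qed
  moreover have "monomial_moment \<mu> m = (\<Prod>i\<in>I. \<Prod>p\<in>UNIV. moment \<mu> (count m (i, p)))"
    using \<open>finite I\<close> m(1) by (subst monomial_moment_superset [OF rd, of "I \<times> UNIV"])
      (simp_all add: prod.cartesian_product case_prod_unfold)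
  ultimately show ?thesis
    using indep_vars_integrable [OF \<open>finite I\<close> ind G(1)]
      indep_vars_lebesgue_integral [OF \<open>finite I\<close> ind G(1)]
    by (simp add: has_bochner_integral_iff G(2))
qed

section \<open>Products of Gram matrices\<close>

locale symmetric_gram =
  symmetric_moments M \<mu> "\<lambda>(i, a, b) \<omega>. Z i \<omega> $ a $ b" "I \<times> UNIV" D
  for M :: "'w measure" and \<mu> :: "real measure" and Z :: "'i \<Rightarrow> 'w \<Rightarrow> real^'r^'d"
    and I :: "'i set" and D :: nat
begin

definition gram :: "'i \<Rightarrow> 'w \<Rightarrow> real^'d^'d" where
  "gram i \<omega> = Z i \<omega> ** transpose (Z i \<omega>)"

lemma gram_nth: "gram i \<omega> $ a $ e = (\<Sum>b\<in>UNIV. Z i \<omega> $ a $ b * Z i \<omega> $ e $ b)"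
  by (simp add: gram_def matrix_matrix_mult_def transpose_def)

lemma pos_poly_gram: "pos_poly ({i} \<times> UNIV) 2 (\<lambda>\<omega>. gram i \<omega> $ a $ e)"
proof -
  have entry: "pos_poly ({i} \<times> UNIV) 1 (\<lambda>\<omega>. Z i \<omega> $ a $ b)" for a b
    using pos_poly_var [of "(i, a, b)" "{i} \<times> UNIV"] by simp
  have "pos_poly ({i} \<times> UNIV) 2 (\<lambda>\<omega>. Z i \<omega> $ a $ b * Z i \<omega> $ e $ b)" for b
    using pos_poly_mult [OF entry entry] by (simp add: numeral_2_eq_2)
  then show ?thesis
    unfolding gram_nth by (intro pos_poly_sum)
qed

text \<open>As \<open>gram\<close> is symmetric, the sum is the (f, g) entry of its square, the
  block in the middle of X^T X.\<close>

lemma pos_poly_gram_mult: "pos_poly ({i} \<times> UNIV) 4 (\<lambda>\<omega>. \<Sum>e\<in>UNIV. gram i \<omega> $ e $ f * gram i \<omega> $ e $ g)"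
  using pos_poly_mult [OF pos_poly_gram [of i] pos_poly_gram [of i]] by (intro pos_poly_sum) simp

lemma pos_poly_prod:
  "pos_poly (i ` {1..k} \<times> UNIV) (2 * k) (\<lambda>\<omega>. ordered_prod k (\<lambda>j. gram (i j) \<omega>) $ a $ b)"
proof (induction k arbitrary: a)
  case 0
  then show ?case by (simp add: mat_def pos_poly_0 pos_poly_1)
next
  case (Suc k)
  have "pos_poly (i ` {1..Suc k} \<times> UNIV) (2 * Suc k)
      (\<lambda>\<omega>. gram (i (Suc k)) \<omega> $ a $ e * ordered_prod k (\<lambda>j. gram (i j) \<omega>) $ e $ b)" for e
    by (rule pos_poly_mono [OF pos_poly_mult [OF pos_poly_gram Suc]]) auto
  then show ?case
    by (simp add: matrix_matrix_mult_def pos_poly_sum)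
qed

lemma pos_poly_prod_mult:
  "pos_poly (i ` {1..k} \<times> UNIV) (4 * k) (\<lambda>\<omega>.
    ordered_prod k (\<lambda>j. gram (i j) \<omega>) $ f $ a * ordered_prod k (\<lambda>j. gram (i j) \<omega>) $ g $ b)"
  using pos_poly_mult [OF pos_poly_prod [of i k] pos_poly_prod [of i k]] by simp

lemma integral_gram:
  assumes "i \<in> I" "2 \<le> D"
  shows "(\<integral>\<omega>. gram i \<omega> $ a $ e \<partial>M) = (if a = e then CARD('r) * moment \<mu> 2 else 0)"
proof -
  have "has_bochner_integral M (\<lambda>\<omega>. \<Prod>v\<in>#{#(i, a, b), (i, e, b)#}. (case v of (i, a, b) \<Rightarrow> \<lambda>\<omega>. Z i \<omega> $ a $ b) \<omega>)
      (monomial_moment \<mu> {#(i, a, b), (i, e, b)#})" for b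
    using assms by (intro monomial) auto
  then have "has_bochner_integral M (\<lambda>\<omega>. gram i \<omega> $ a $ e) (\<Sum>b\<in>(UNIV :: 'r set). monomial_moment \<mu> {#(i, a, b), (i, e, b)#})"
    unfolding gram_nth by (intro has_bochner_integral_sum) simp
  then have "(\<integral>\<omega>. gram i \<omega> $ a $ e \<partial>M) = (\<Sum>b\<in>(UNIV :: 'r set). monomial_moment \<mu> {#(i, a, b), (i, e, b)#})"
    by (rule has_bochner_integral_integral_eq)
  moreover have "monomial_moment \<mu> {#(i, a, b), (i, a, b)#} = moment \<mu> 2" for b :: 'r
    by (simp add: monomial_moment_def numeral_2_eq_2)
  \<comment> \<open>Row \<open>a\<close> contributes exactly one variable, an odd number.\<close>
  moreover have "monomial_moment \<mu> {#(i, a, b), (i, e, b)#} = 0" if "a \<noteq> e" for b :: 'r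
    using that by (intro monomial_moment_odd [OF sym, of "\<lambda>v. fst (snd v) = a"]) simp
  ultimately show ?thesis by auto
qed

text \<open>Orthogonality comes from the sign symmetry of a single row; the constant does not depend on
  \<open>i\<close> and \<open>f\<close> because permuting the variables preserves all joint moments.\<close>

lemma integral_gram_mult:
  assumes "4 \<le> D"
  obtains c where "0 \<le> c"
    "\<And>i f g. i \<in> I \<Longrightarrow> (\<integral>\<omega>. (\<Sum>e\<in>UNIV. gram i \<omega> $ e $ f * gram i \<omega> $ e $ g) \<partial>M) = (if f = g then c else 0)"
proof -
  \<comment> \<open>These are the degree-four monomials obtained by writing both \<open>gram\<close>
    entries as sums over columns \<open>b\<close> and \<open>b'\<close>.\<close>
  define m where "m i e f g b b' = {#(i, e, b), (i, f, b), (i, e, b'), (i, g, b')#}"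
    for i :: 'i and e f g :: 'd and b b' :: 'r
  define q where "q i f g = (\<Sum>e\<in>UNIV. \<Sum>b\<in>UNIV. \<Sum>b'\<in>UNIV. monomial_moment \<mu> (m i e f g b b'))" for i f g
  have int: "(\<integral>\<omega>. (\<Sum>e\<in>UNIV. gram i \<omega> $ e $ f * gram i \<omega> $ e $ g) \<partial>M) = q i f g" if "i \<in> I" for i f g
  proof (rule has_bochner_integral_integral_eq)
    have "has_bochner_integral M (\<lambda>\<omega>. \<Prod>v\<in>#m i e f g b b'. (case v of (i, a, b) \<Rightarrow> \<lambda>\<omega>. Z i \<omega> $ a $ b) \<omega>)
        (monomial_moment \<mu> (m i e f g b b'))" for e b b'
      using assms that by (intro monomial) (auto simp: m_def)
    then show "has_bochner_integral M (\<lambda>\<omega>. \<Sum>e\<in>UNIV. gram i \<omega> $ e $ f * gram i \<omega> $ e $ g) (q i f g)"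
      unfolding gram_nth q_def sum_product
      by (intro has_bochner_integral_sum) (simp add: m_def mult.assoc)
  qed
  have orthogonal: "q i f g = 0" if "f \<noteq> g" for i f g
  proof -
    \<comment> \<open>Since f and g differ, row \<open>f\<close> occurs three times if e = f and
      once otherwise.\<close>
    have "monomial_moment \<mu> (m i e f g b b') = 0" for e b b'
      using that by (intro monomial_moment_odd [OF sym, of "\<lambda>v. fst (snd v) = f"]) (auto simp: m_def)
    then show ?thesis by (simp add: q_def)
  qed
  have diagonal: "q i f f = q i' f' f'" for i i' f f'
  proof -
    let ?t = "Transposition.transpose f f'"
    \<comment> \<open>\<open>h\<close> swaps the matrices \<open>i\<close>, \<open>i'\<close> and
      the rows \<open>f\<close>, \<open>f'\<close>. It also moves the summation index
      \<open>e\<close>, which is undone by reindexing the sum over rows.\<close>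
    define h where "h = map_prod (Transposition.transpose i i') (map_prod ?t (id :: 'r \<Rightarrow> 'r))"
    have "inj h"
      unfolding h_def by (intro prod.inj_map) (simp_all add: bij_is_inj)
    have "monomial_moment \<mu> (m i e f f b b') = monomial_moment \<mu> (m i' (?t e) f' f' b b')" for e b b'
      using monomial_moment_image_inj [OF \<open>inj h\<close>, of \<mu> "m i e f f b b'"] by (simp add: m_def h_def)
    then have "q i f f = (\<Sum>e\<in>UNIV. \<Sum>b\<in>UNIV. \<Sum>b'\<in>UNIV. monomial_moment \<mu> (m i' (?t e) f' f' b b'))"
      by (simp add: q_def)
    also have "\<dots> = q i' f' f'"
      unfolding q_def by (rule sum.reindex_bij_betw) simp
    finally show ?thesis .
  qed
  show thesis
  proof
    \<comment> \<open>By \<open>diagonal\<close> any choice of indices gives the same constant, so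
      arbitrary ones serve.\<close>
    show "0 \<le> q undefined undefined undefined"
      by (simp add: q_def sum_nonneg monomial_moment_nonneg [OF sym])
    show "(\<integral>\<omega>. (\<Sum>e\<in>UNIV. gram i \<omega> $ e $ f * gram i \<omega> $ e $ g) \<partial>M)
        = (if f = g then q undefined undefined undefined else 0)" if "i \<in> I" for i f g
      using int [OF that, of f g] orthogonal [of f g i] diagonal [of i f undefined undefined] by auto
  qed
qed

section \<open>First inequality: entries of the expected product\<close>

text \<open>The leftmost factor shares no variables with the rest, so each entry product factorises.
  The expected factor is a scalar matrix, which leaves a single summand. Peeling changes the row
  index, so the induction generalises \<open>a\<close>.\<close>

lemma integral_prod_distinct:
  assumes "2 * k \<le> D" "i ` {1..k} \<subseteq> I" "inj_on i {1..k}"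
  shows "(\<integral>\<omega>. ordered_prod k (\<lambda>j. gram (i j) \<omega>) $ a $ b \<partial>M)
    = (if a = b then (CARD('r) * moment \<mu> 2) ^ k else 0)"
  using assms
proof (induction k arbitrary: a)
  case 0
  show ?case using integral_1 by (simp add: mat_def)
next
  case (Suc k)
  let ?X = "\<lambda>\<omega>. ordered_prod k (\<lambda>j. gram (i j) \<omega>)" and ?B = "gram (i (Suc k))"
  have i: "i (Suc k) \<in> I" "i ` {1..k} \<subseteq> I" "i (Suc k) \<notin> i ` {1..k}"
    using Suc.prems inj_on_image_mem_iff [OF Suc.prems(3), of "Suc k" "{1..k}"] by auto
  have IH: "(\<integral>\<omega>. ?X \<omega> $ a $ b \<partial>M) = (if a = b then (CARD('r) * moment \<mu> 2) ^ k else 0)" for a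
    using Suc.prems i by (intro Suc.IH) (auto intro: inj_on_subset)
  have int: "integrable M (\<lambda>\<omega>. ?B \<omega> $ a $ e * ?X \<omega> $ e $ b)" for e
    using Suc.prems(1) i
    by (intro pos_poly_integrable [OF pos_poly_mono [OF pos_poly_mult [OF pos_poly_gram pos_poly_prod] _ order_refl]]) auto
  have "(\<integral>\<omega>. ?B \<omega> $ a $ e * ?X \<omega> $ e $ b \<partial>M) = (\<integral>\<omega>. ?B \<omega> $ a $ e \<partial>M) * (\<integral>\<omega>. ?X \<omega> $ e $ b \<partial>M)" for e
    using Suc.prems(1) i by (intro pos_poly_integral_mult_disjoint [OF pos_poly_gram pos_poly_prod]) auto
  \<comment> \<open>Here \<open>\<dots>\<close> is a function of \<open>e\<close>, because the
    preceding fact is general in \<open>e\<close>.\<close>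
  also have "\<dots> e = (if e = a then if a = b then (CARD('r) * moment \<mu> 2) ^ Suc k else 0 else 0)" for e
    using Suc.prems(1) i by (simp add: integral_gram IH)
  finally have "(\<Sum>e\<in>UNIV. \<integral>\<omega>. ?B \<omega> $ a $ e * ?X \<omega> $ e $ b \<partial>M)
      = (\<Sum>e\<in>UNIV. if e = a then if a = b then (CARD('r) * moment \<mu> 2) ^ Suc k else 0 else 0)"
    by (rule sum.cong [OF refl])
  then show ?case
    using int by (cases "a = b") (auto simp: matrix_matrix_mult_def)
qed

text \<open>With repeated indices factorisation becomes positive correlation: the summand e = a
  alone already dominates the constant, and the others have nonnegative expectation.\<close>

lemma integral_prod_ge:
  assumes "2 * k \<le> D" "i ` {1..k} \<subseteq> I"
  shows "(CARD('r) * moment \<mu> 2) ^ k \<le> (\<integral>\<omega>. ordered_prod k (\<lambda>j. gram (i j) \<omega>) $ a $ a \<partial>M)"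
  using assms
proof (induction k)
  case 0
  then show ?case
    using integral_prod_distinct [of 0 i a a] by simp
next
  case (Suc k)
  let ?X = "\<lambda>\<omega>. ordered_prod k (\<lambda>j. gram (i j) \<omega>)" and ?B = "gram (i (Suc k))"
  have i: "i (Suc k) \<in> I" "i ` {1..k} \<subseteq> I"
    using Suc.prems by auto
  have pos: "pos_poly (I \<times> UNIV) (2 + 2 * k) (\<lambda>\<omega>. ?B \<omega> $ a $ e * ?X \<omega> $ e $ a)" for e
    using i by (intro pos_poly_mono [OF pos_poly_mult [OF pos_poly_gram pos_poly_prod] _ order_refl]) auto
  have "(CARD('r) * moment \<mu> 2) ^ Suc k \<le> (CARD('r) * moment \<mu> 2) * (\<integral>\<omega>. ?X \<omega> $ a $ a \<partial>M)"
    using Suc i by (simp add: mult_left_mono moment_nonneg [OF sym])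
  also have "\<dots> = (\<integral>\<omega>. ?B \<omega> $ a $ a \<partial>M) * (\<integral>\<omega>. ?X \<omega> $ a $ a \<partial>M)"
    using Suc.prems i by (simp add: integral_gram)
  also have "\<dots> \<le> (\<integral>\<omega>. ?B \<omega> $ a $ a * ?X \<omega> $ a $ a \<partial>M)"
    using Suc.prems(1) i by (intro pos_poly_integral_mult_ge [OF pos_poly_gram pos_poly_prod]) auto
  also have "\<dots> \<le> (\<Sum>e\<in>UNIV. \<integral>\<omega>. ?B \<omega> $ a $ e * ?X \<omega> $ e $ a \<partial>M)"
    by (rule member_le_sum) (use Suc.prems(1) in \<open>auto intro!: pos_poly_integral_nonneg [OF pos]\<close>)
  also have "\<dots> = (\<integral>\<omega>. ordered_prod (Suc k) (\<lambda>j. gram (i j) \<omega>) $ a $ a \<partial>M)"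
    using Suc.prems(1) pos_poly_integrable [OF pos] by (simp add: matrix_matrix_mult_def)
  finally show ?case .
qed

section \<open>Second inequality: entries of the expected X^T X\<close>

text \<open>The two copies of the last factor meet in the middle of X^T X. Summing over
  \<open>e\<close> innermost exposes them as one block, with outer indices \<open>a\<close> and
  \<open>b\<close> untouched.\<close>

lemma transpose_mult_ordered_prod_Suc_nth:
  fixes B :: "nat \<Rightarrow> real^'d^'d"
  shows "(transpose (ordered_prod (Suc k) B) ** ordered_prod (Suc k) B) $ a $ b
    = (\<Sum>f\<in>UNIV. \<Sum>g\<in>UNIV. (\<Sum>e\<in>UNIV. B (Suc k) $ e $ f * B (Suc k) $ e $ g)
        * (ordered_prod k B $ f $ a * ordered_prod k B $ g $ b))"
proof -
  let ?X = "ordered_prod k B" and ?B = "B (Suc k)"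
  have "(transpose (ordered_prod (Suc k) B) ** ordered_prod (Suc k) B) $ a $ b
      = (\<Sum>e\<in>UNIV. \<Sum>f\<in>UNIV. \<Sum>g\<in>UNIV. (?B $ e $ f * ?B $ e $ g) * (?X $ f $ a * ?X $ g $ b))"
    by (simp add: matrix_matrix_mult_def transpose_def sum_product mult_ac)
  also have "\<dots> = (\<Sum>f\<in>UNIV. \<Sum>e\<in>UNIV. \<Sum>g\<in>UNIV. (?B $ e $ f * ?B $ e $ g) * (?X $ f $ a * ?X $ g $ b))"
    by (rule sum.swap)
  also have "\<dots> = (\<Sum>f\<in>UNIV. \<Sum>g\<in>UNIV. \<Sum>e\<in>UNIV. (?B $ e $ f * ?B $ e $ g) * (?X $ f $ a * ?X $ g $ b))"
    by (intro sum.cong refl sum.swap)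
  finally show ?thesis
    by (simp add: sum_distrib_right)
qed

lemma pos_poly_transpose_mult_prod:
  "pos_poly (i ` {1..k} \<times> UNIV) (4 * k) (\<lambda>\<omega>.
    (transpose (ordered_prod k (\<lambda>j. gram (i j) \<omega>)) ** ordered_prod k (\<lambda>j. gram (i j) \<omega>)) $ a $ b)"
  by (simp add: matrix_matrix_mult_def transpose_def del: One_nat_def)
    (intro pos_poly_sum pos_poly_prod_mult)

lemma pos_poly_transpose_mult_step:
  assumes "i ` {1..Suc k} \<subseteq> I"
  shows "pos_poly (I \<times> UNIV) (4 * Suc k) (\<lambda>\<omega>. (\<Sum>e\<in>UNIV. gram (i (Suc k)) \<omega> $ e $ f * gram (i (Suc k)) \<omega> $ e $ g)
    * (ordered_prod k (\<lambda>j. gram (i j) \<omega>) $ f $ a * ordered_prod k (\<lambda>j. gram (i j) \<omega>) $ g $ b))"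
  using assms
  by (intro pos_poly_mono [OF pos_poly_mult [OF pos_poly_gram_mult pos_poly_prod_mult]]) auto

lemma integral_transpose_mult_prod_Suc:
  assumes "4 * Suc k \<le> D" "i ` {1..Suc k} \<subseteq> I"
  shows "(\<integral>\<omega>. (transpose (ordered_prod (Suc k) (\<lambda>j. gram (i j) \<omega>)) ** ordered_prod (Suc k) (\<lambda>j. gram (i j) \<omega>)) $ a $ b \<partial>M)
    = (\<Sum>f\<in>UNIV. \<Sum>g\<in>UNIV. \<integral>\<omega>. (\<Sum>e\<in>UNIV. gram (i (Suc k)) \<omega> $ e $ f * gram (i (Suc k)) \<omega> $ e $ g)
        * (ordered_prod k (\<lambda>j. gram (i j) \<omega>) $ f $ a * ordered_prod k (\<lambda>j. gram (i j) \<omega>) $ g $ b) \<partial>M)"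
proof -
  note int = pos_poly_integrable [OF pos_poly_transpose_mult_step [OF assms(2)] assms(1)]
  show ?thesis
    unfolding transpose_mult_ordered_prod_Suc_nth
    by (subst Bochner_Integration.integral_sum, intro Bochner_Integration.integrable_sum int,
        intro sum.cong refl Bochner_Integration.integral_sum int)
qed

text \<open>The constant c is that of the expected square of a Gram matrix. Both parts peel this
  middle block: by factorisation for distinct indices, by positive correlation in general.\<close>

lemma integral_transpose_mult_prod:
  assumes "4 * k \<le> D" "i ` {1..k} \<subseteq> I" "0 \<le> c"
    and c: "\<And>i f g. i \<in> I \<Longrightarrow>
      (\<integral>\<omega>. (\<Sum>e\<in>UNIV. gram i \<omega> $ e $ f * gram i \<omega> $ e $ g) \<partial>M) = (if f = g then c else 0)"
  shows integral_transpose_mult_prod_distinct: "inj_on i {1..k} \<Longrightarrow>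
      (\<integral>\<omega>. (transpose (ordered_prod k (\<lambda>j. gram (i j) \<omega>)) ** ordered_prod k (\<lambda>j. gram (i j) \<omega>)) $ a $ b \<partial>M)
      = (if a = b then c ^ k else 0)"
    and integral_transpose_mult_prod_ge: "c ^ k \<le>
      (\<integral>\<omega>. (transpose (ordered_prod k (\<lambda>j. gram (i j) \<omega>)) ** ordered_prod k (\<lambda>j. gram (i j) \<omega>)) $ a $ a \<partial>M)"
proof -
  let ?X = "\<lambda>k \<omega>. ordered_prod k (\<lambda>j. gram (i j) \<omega>)"
  let ?B = "\<lambda>k f g \<omega>. \<Sum>e\<in>UNIV. gram (i (Suc k)) \<omega> $ e $ f * gram (i (Suc k)) \<omega> $ e $ g"
  have nth: "(\<integral>\<omega>. (transpose (?X k \<omega>) ** ?X k \<omega>) $ a $ b \<partial>M) = (\<Sum>f\<in>UNIV. \<integral>\<omega>. ?X k \<omega> $ f $ a * ?X k \<omega> $ f $ b \<partial>M)"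
    if "4 * k \<le> D" "i ` {1..k} \<subseteq> I" for k a b
  proof -
    have "integrable M (\<lambda>\<omega>. ?X k \<omega> $ f $ a * ?X k \<omega> $ f $ b)" for f
      using that by (intro pos_poly_integrable [OF pos_poly_mono [OF pos_poly_prod_mult _ order_refl]]) auto
    then show ?thesis
      by (simp add: matrix_matrix_mult_def transpose_def)
  qed
  have base: "(\<integral>\<omega>. (transpose (?X 0 \<omega>) ** ?X 0 \<omega>) $ a $ b \<partial>M) = (if a = b then c ^ 0 else 0)" for a b
    using integral_prod_distinct [of 0 i a b] by (simp add: transpose_mat)
  show "(\<integral>\<omega>. (transpose (?X k \<omega>) ** ?X k \<omega>) $ a $ b \<partial>M) = (if a = b then c ^ k else 0)"
    if "inj_on i {1..k}"
    using assms(1,2) that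
  proof (induction k)
    case 0
    show ?case by (rule base)
  next
    case (Suc k)
    have i: "i (Suc k) \<in> I" "i ` {1..k} \<subseteq> I" "i (Suc k) \<notin> i ` {1..k}" "inj_on i {1..k}"
      using Suc.prems inj_on_image_mem_iff [OF Suc.prems(3), of "Suc k" "{1..k}"]
      by (auto intro: inj_on_subset)
    have "(\<integral>\<omega>. ?B k f g \<omega> * (?X k \<omega> $ f $ a * ?X k \<omega> $ g $ b) \<partial>M)
        = (\<integral>\<omega>. ?B k f g \<omega> \<partial>M) * (\<integral>\<omega>. ?X k \<omega> $ f $ a * ?X k \<omega> $ g $ b \<partial>M)" for f g
      using Suc.prems(1) i
      by (intro pos_poly_integral_mult_disjoint [OF pos_poly_gram_mult pos_poly_prod_mult]) auto
    \<comment> \<open>The expected block is c times the identity, so only f = g survives and the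
      rest is again an entry of the shorter X^T X.\<close>
    then have "(\<integral>\<omega>. (transpose (?X (Suc k) \<omega>) ** ?X (Suc k) \<omega>) $ a $ b \<partial>M)
        = c * (\<Sum>f\<in>UNIV. \<integral>\<omega>. ?X k \<omega> $ f $ a * ?X k \<omega> $ f $ b \<partial>M)"
      by (simp only: integral_transpose_mult_prod_Suc [OF Suc.prems(1,2)] c [OF i(1)])
        (simp add: if_distrib [of "\<lambda>t. t * _"] sum_distrib_left cong: if_cong)
    also have "\<dots> = (if a = b then c ^ Suc k else 0)"
      using Suc i by (simp flip: nth)
    finally show ?case .
  qed
  show "c ^ k \<le> (\<integral>\<omega>. (transpose (?X k \<omega>) ** ?X k \<omega>) $ a $ a \<partial>M)"
    using assms(1,2)
  proof (induction k)
    case 0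
    then show ?case using base [of a a] by simp
  next
    case (Suc k)
    have i: "i (Suc k) \<in> I" "i ` {1..k} \<subseteq> I"
      using Suc.prems by auto
    have "c ^ Suc k \<le> c * (\<integral>\<omega>. (transpose (?X k \<omega>) ** ?X k \<omega>) $ a $ a \<partial>M)"
      using Suc i \<open>0 \<le> c\<close> by (simp add: mult_left_mono)
    also have "\<dots> = (\<Sum>f\<in>UNIV. (\<integral>\<omega>. ?B k f f \<omega> \<partial>M) * (\<integral>\<omega>. ?X k \<omega> $ f $ a * ?X k \<omega> $ f $ a \<partial>M))"
      using Suc.prems i by (simp add: nth c sum_distrib_left)
    \<comment> \<open>Positive correlation is applied to the terms with f = g; afterwards the terms
      with f and g different, of nonnegative expectation, are added.\<close>
    also have "\<dots> \<le> (\<Sum>f\<in>UNIV. \<integral>\<omega>. ?B k f f \<omega> * (?X k \<omega> $ f $ a * ?X k \<omega> $ f $ a) \<partial>M)"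
      using Suc.prems(1) i
      by (intro sum_mono pos_poly_integral_mult_ge [OF pos_poly_gram_mult pos_poly_prod_mult]) auto
    also have "\<dots> \<le> (\<Sum>f\<in>UNIV. \<Sum>g\<in>UNIV. \<integral>\<omega>. ?B k f g \<omega> * (?X k \<omega> $ f $ a * ?X k \<omega> $ g $ a) \<partial>M)"
    proof (intro sum_mono)
      fix f
      show "(\<integral>\<omega>. ?B k f f \<omega> * (?X k \<omega> $ f $ a * ?X k \<omega> $ f $ a) \<partial>M)
          \<le> (\<Sum>g\<in>UNIV. \<integral>\<omega>. ?B k f g \<omega> * (?X k \<omega> $ f $ a * ?X k \<omega> $ g $ a) \<partial>M)"
        by (rule member_le_sum [where f = "\<lambda>g. \<integral>\<omega>. ?B k f g \<omega> * (?X k \<omega> $ f $ a * ?X k \<omega> $ g $ a) \<partial>M"])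
          (auto intro!: pos_poly_integral_nonneg [OF pos_poly_transpose_mult_step [OF Suc.prems(2)] Suc.prems(1)])
    qed
    also have "\<dots> = (\<integral>\<omega>. (transpose (?X (Suc k) \<omega>) ** ?X (Suc k) \<omega>) $ a $ a \<partial>M)"
      by (rule integral_transpose_mult_prod_Suc [OF Suc.prems, symmetric])
    finally show ?case .
  qed
qed

end

section \<open>Comparison of sampling without and with replacement\<close>

theorem proposition4p1:
  fixes M :: "'w measure" and \<mu> :: "real measure" and n k :: nat
    and Z :: "nat \<Rightarrow> 'w \<Rightarrow> real^'r^'d"
    and A :: "nat \<Rightarrow> 'w \<Rightarrow> real^'d^'d"
  assumes "1 \<le> k" and "k \<le> n"
    and "prob_space M"
    and "prob_space.indep_vars M (\<lambda>_. borel) Z {1..n}"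
    and "\<And>i. i \<in> {1..n} \<Longrightarrow>
      prob_space.indep_vars M (\<lambda>_. borel) (\<lambda>(a, b) \<omega>. Z i \<omega> $ a $ b) UNIV"
    and "\<And>i a b. i \<in> {1..n} \<Longrightarrow> distr M borel (\<lambda>\<omega>. Z i \<omega> $ a $ b) = \<mu>"
    and "symmetric_distribution \<mu>"
    and "\<And>i \<omega>. i \<in> {1..n} \<Longrightarrow> \<omega> \<in> space M \<Longrightarrow> A i \<omega> = Z i \<omega> ** transpose (Z i \<omega>)"
  shows "(integrable \<mu> (\<lambda>x. \<bar>x\<bar> ^ (2 * k)) \<longrightarrow>
      onorm ((*v) (\<integral>\<omega>. E_wo n k (\<lambda>B. ordered_prod k B) (\<lambda>i. A i \<omega>) \<partial>M))
      \<le> onorm ((*v) (\<integral>\<omega>. E_wr n k (\<lambda>B. ordered_prod k B) (\<lambda>i. A i \<omega>) \<partial>M)))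
    \<and> (integrable \<mu> (\<lambda>x. \<bar>x\<bar> ^ (4 * k)) \<longrightarrow>
      onorm ((*v) (\<integral>\<omega>. E_wo n k
        (\<lambda>B. ordered_prod k (\<lambda>j. B (k - j + 1)) ** ordered_prod k B) (\<lambda>i. A i \<omega>) \<partial>M))
      \<le> onorm ((*v) (\<integral>\<omega>. E_wr n k
        (\<lambda>B. ordered_prod k (\<lambda>j. B (k - j + 1)) ** ordered_prod k B) (\<lambda>i. A i \<omega>) \<partial>M)))"
proof -
  interpret prob_space M by fact
  \<comment> \<open>The order \<open>D\<close> stays open because the two inequalities use it with
    2k and 4k.\<close>
  have gram: "symmetric_gram M \<mu> Z {1..n} D" if "integrable \<mu> (\<lambda>t. \<bar>t\<bar> ^ D)" for D
    by unfold_locales (fact that assms | rule has_bochner_integral_monomial [OF assms(7) that _ assms(4-6)], auto)+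
  show ?thesis
  proof (intro conjI impI)
    assume int: "integrable \<mu> (\<lambda>x. \<bar>x\<bar> ^ (2 * k))"
    interpret symmetric_gram M \<mu> Z "{1..n}" "2 * k" by (rule gram [OF int])
    show "onorm ((*v) (\<integral>\<omega>. E_wo n k (\<lambda>B. ordered_prod k B) (\<lambda>i. A i \<omega>) \<partial>M))
        \<le> onorm ((*v) (\<integral>\<omega>. E_wr n k (\<lambda>B. ordered_prod k B) (\<lambda>i. A i \<omega>) \<partial>M))"
    proof (rule onorm_E_wo_le_E_wr [where c = "(CARD('r) * moment \<mu> 2) ^ k"
          and g = "\<lambda>i \<omega>. ordered_prod k (\<lambda>j. gram (i j) \<omega>)"])
      show "0 \<le> (CARD('r) * moment \<mu> 2) ^ k"
        by (simp add: moment_nonneg [OF sym])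
      fix i assume "i \<in> {1..k} \<rightarrow>\<^sub>E {1..n}"
      then have i: "i ` {1..k} \<subseteq> {1..n}"
        by auto
      show "ordered_prod k (\<lambda>j. A (i j) \<omega>) = ordered_prod k (\<lambda>j. gram (i j) \<omega>)" if "\<omega> \<in> space M" for \<omega>
        using i that by (intro ordered_prod_cong) (simp add: gram_def assms(8) image_subset_iff del: One_nat_def)
      show "integrable M (\<lambda>\<omega>. ordered_prod k (\<lambda>j. gram (i j) \<omega>) $ a $ b)" for a b
        using i by (intro pos_poly_integrable [OF pos_poly_mono [OF pos_poly_prod _ order_refl]]) auto
      show "(\<integral>\<omega>. ordered_prod k (\<lambda>j. gram (i j) \<omega>) $ a $ b \<partial>M)
          = (if a = b then (CARD('r) * moment \<mu> 2) ^ k else 0)" if "inj_on i {1..k}" for a b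
        using i that by (intro integral_prod_distinct order_refl)
      show "(CARD('r) * moment \<mu> 2) ^ k \<le> (\<integral>\<omega>. ordered_prod k (\<lambda>j. gram (i j) \<omega>) $ a $ a \<partial>M)" for a
        using i by (intro integral_prod_ge order_refl)
    qed fact
  next
    assume int: "integrable \<mu> (\<lambda>x. \<bar>x\<bar> ^ (4 * k))"
    interpret symmetric_gram M \<mu> Z "{1..n}" "4 * k" by (rule gram [OF int])
    \<comment> \<open>Since k is at least 1, the moment assumption covers fourth moments, on which c
      depends.\<close>
    have "4 \<le> 4 * k"
      using \<open>1 \<le> k\<close> by simp
    then obtain c where "0 \<le> c" and c: "\<And>i f g. i \<in> {1..n} \<Longrightarrow>
        (\<integral>\<omega>. (\<Sum>e\<in>UNIV. gram i \<omega> $ e $ f * gram i \<omega> $ e $ g) \<partial>M) = (if f = g then c else 0)"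
      by (rule integral_gram_mult) (rule that)
    show "onorm ((*v) (\<integral>\<omega>. E_wo n k
          (\<lambda>B. ordered_prod k (\<lambda>j. B (k - j + 1)) ** ordered_prod k B) (\<lambda>i. A i \<omega>) \<partial>M))
        \<le> onorm ((*v) (\<integral>\<omega>. E_wr n k
          (\<lambda>B. ordered_prod k (\<lambda>j. B (k - j + 1)) ** ordered_prod k B) (\<lambda>i. A i \<omega>) \<partial>M))"
    proof (rule onorm_E_wo_le_E_wr [where c = "c ^ k"
          and g = "\<lambda>i \<omega>. transpose (ordered_prod k (\<lambda>j. gram (i j) \<omega>)) ** ordered_prod k (\<lambda>j. gram (i j) \<omega>)"])
      show "0 \<le> c ^ k"
        using \<open>0 \<le> c\<close> by simp
      fix i assume "i \<in> {1..k} \<rightarrow>\<^sub>E {1..n}"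
      then have i: "i ` {1..k} \<subseteq> {1..n}"
        by auto
      show "ordered_prod k (\<lambda>j. A (i (k - j + 1)) \<omega>) ** ordered_prod k (\<lambda>j. A (i j) \<omega>)
          = transpose (ordered_prod k (\<lambda>j. gram (i j) \<omega>)) ** ordered_prod k (\<lambda>j. gram (i j) \<omega>)"
        if "\<omega> \<in> space M" for \<omega>
      proof -
        have A: "A (i j) \<omega> = gram (i j) \<omega>" if "j \<in> {1..k}" for j
          using i that \<open>\<omega> \<in> space M\<close> by (simp add: gram_def assms(8) image_subset_iff del: One_nat_def)
        have "ordered_prod k (\<lambda>j. A (i (k - j + 1)) \<omega>) = transpose (ordered_prod k (\<lambda>j. A (i j) \<omega>))"
          by (rule symmetric_matrix_rev_ordered_prod [of k "\<lambda>j. A (i j) \<omega>"])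
            (simp add: A gram_def matrix_transpose_mul del: One_nat_def)
        moreover have "ordered_prod k (\<lambda>j. A (i j) \<omega>) = ordered_prod k (\<lambda>j. gram (i j) \<omega>)"
          by (rule ordered_prod_cong) (rule A)
        ultimately show ?thesis by simp
      qed
      show "integrable M (\<lambda>\<omega>. (transpose (ordered_prod k (\<lambda>j. gram (i j) \<omega>)) ** ordered_prod k (\<lambda>j. gram (i j) \<omega>)) $ a $ b)"
        for a b
        using i by (intro pos_poly_integrable [OF pos_poly_mono [OF pos_poly_transpose_mult_prod _ order_refl]]) auto
      show "(\<integral>\<omega>. (transpose (ordered_prod k (\<lambda>j. gram (i j) \<omega>)) ** ordered_prod k (\<lambda>j. gram (i j) \<omega>)) $ a $ b \<partial>M)
          = (if a = b then c ^ k else 0)" if "inj_on i {1..k}" for a b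
        using i \<open>0 \<le> c\<close> c that by (intro integral_transpose_mult_prod_distinct) auto
      show "c ^ k \<le> (\<integral>\<omega>. (transpose (ordered_prod k (\<lambda>j. gram (i j) \<omega>)) ** ordered_prod k (\<lambda>j. gram (i j) \<omega>)) $ a $ a \<partial>M)" for a
        using i \<open>0 \<le> c\<close> c by (intro integral_transpose_mult_prod_ge) auto
    qed fact
  qed
qed

end
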